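(* Let $\psi$ be a homomorphism such that the induced abstract process $P_\psi$ is an MDP. Let $\Pi:\mathcal H\to\Delta(\mathcal A)$ be any policy, let $\pi_R$ be a representative abstract policy of $\Pi$ (any choice of representatives), and let $Q^\Pi(\psi^{-1}(s,b))$ be any choice of representative action-values. Put $\varepsilon_{\max}:=\max_{\tilde s\in\mathcal S}\left(\varepsilon_Q(\tilde s)+\frac{\varepsilon_\Pi(\tilde s)}{1-\gamma}\right)$. Then for all $h\in\mathcal H$, $a\in\mathcal A$ and $(s,b)=\psi(h,a)$, $$\left|q^{\pi_R}(s,b)-Q^\Pi(h,a)\right|\le\frac{\gamma\,\varepsilon_{\max}}{1-\gamma}\qquad\text{and}\qquad\left|v^{\pi_R}(s)-V^\Pi(h)\right|\le\frac{\varepsilon_{\max}}{1-\gamma}.$$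
   Context: Setting. $\mathcal A$ (actions), $\mathcal O$ (observations), $\mathcal R\subseteq[0,1]$ (rewards) are finite nonempty sets; $\gamma\in[0,1)$; $\Delta(X)$ is the set of probability distributions on $X$. $\mathcal H:=\bigcup_{t\ge0}(\mathcal A\times\mathcal O\times\mathcal R)^t$ is the set of finite histories. The original process is a map $P:\mathcal H\times\mathcal A\to\Delta(\mathcal O\times\mathcal R)$, written $P(or|ha)$ (arbitrary dependence on the history). A policy is a map $\Pi:\mathcal H\to\Delta(\mathcal A)$, written $\Pi(a|h)$. Its (action-)value functions are the unique bounded functions with $Q^\Pi(h,a)=\sum_{o,r}P(or|ha)\,(r+\gamma V^\Pi(haor))$ and $V^\Pi(h)=\sum_{a}Q^\Pi(h,a)\Pi(a|h)$, where $haor$ is the history $h$ extended by $(a,o,r)$. Homomorphism. $\mathcal S$ and $\mathcal B$ are finite nonempty sets (abstract states and abstract actions). A homomorphism is a surjective map $\psi:\mathcal H\times\mathcal A\to\mathcal S\times\mathcal B$ whose state component depends only on the history: $\psi(h,a)=(f(h),b)$ for a surjective $f:\mathcal H\to\mathcal S$ (while $b$ may depend on both $h$ and $a$). Write $\psi(h)=s$ for $f(h)=s$, and, for $f(h)=s$, $\psi_s^{-1}(b):=\{a\in\mathcal A:\psi(h,a)=(s,b)\}$ (it depends on $h$). The induced abstract process is $P_\psi(s'r|ha):=\sum_{o:\psi(haor)=s'}P(or|ha)$, and the induced abstract policy is $\Pi_\psi(b|h):=\sum_{a\in\psi_s^{-1}(b)}\Pi(a|h)$ with $s=\psi(h)$.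 $P_\psi$ is an MDP if there is $p_{\mathrm{MDP}}:\mathcal S\times\mathcal B\to\Delta(\mathcal S\times\mathcal R)$ with $P_\psi(s'r|ha)=p_{\mathrm{MDP}}(s'r|sb)$ for all $\psi(h,a)=(s,b)$ and all $s'\in\mathcal S,r\in\mathcal R$. For an abstract policy $\pi:\mathcal S\to\Delta(\mathcal B)$, $q^\pi,v^\pi$ are the solutions of $q^\pi(s,b)=\sum_{s',r}p_{\mathrm{MDP}}(s'r|sb)(r+\gamma v^\pi(s'))$, $v^\pi(s)=\sum_bq^\pi(s,b)\pi(b|s)$. Representatives. $\pi_R(\cdot|s):=\Pi_\psi(\cdot|\tilde h)$ for some (arbitrarily chosen) $\tilde h$ with $\psi(\tilde h)=s$; $\varepsilon_\Pi(s):=\sup_{\tilde h:\psi(\tilde h)=s}\|\pi_R(\cdot|s)-\Pi_\psi(\cdot|\tilde h)\|_1$. $Q^\Pi(\psi^{-1}(s,b)):=Q^\Pi(\tilde h,\tilde a)$ for some (arbitrarily chosen) $(\tilde h,\tilde a)$ with $\psi(\tilde h,\tilde a)=(s,b)$; $\varepsilon_Q(s):=\sup_{\tilde h,\tilde a,\tilde b:\psi(\tilde h,\tilde a)=(s,\tilde b)}|Q^\Pi(\psi^{-1}(s,\tilde b))-Q^\Pi(\tilde h,\tilde a)|$. *)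

theory Defs
  imports "HOL-Probability.Probability"
begin

(* The finite nonempty sets of actions, observations, abstract states and abstract actions
   are the types 'a, 'o, 's, 'b of class finite; the reward set is an explicit finite
   set R of reals. *)

type_synonym ('a, 'o) history = "('a \<times> 'o \<times> real) list"

definition histories :: "real set \<Rightarrow> ('a, 'o) history set" where
  "histories R = lists (UNIV \<times> UNIV \<times> R)"

definition extend :: "('a, 'o) history \<Rightarrow> 'a \<Rightarrow> 'o \<Rightarrow> real \<Rightarrow> ('a, 'o) history" where
  "extend h a x r = h @ [(a, x, r)]"

definition history_process ::
  "real set \<Rightarrow> (('a, 'o) history \<Rightarrow> 'a \<Rightarrow> ('o \<times> real) pmf) \<Rightarrow> bool" where
  "history_process R P \<longleftrightarrow> (\<forall>h\<in>histories R. \<forall>a. set_pmf (P h a) \<subseteq> UNIV \<times> R)"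


definition is_value_pair ::
  "real set \<Rightarrow> real \<Rightarrow> (('a::finite, 'o::finite) history \<Rightarrow> 'a \<Rightarrow> ('o \<times> real) pmf)
    \<Rightarrow> (('a, 'o) history \<Rightarrow> 'a pmf)
    \<Rightarrow> (('a, 'o) history \<Rightarrow> 'a \<Rightarrow> real) \<Rightarrow> (('a, 'o) history \<Rightarrow> real) \<Rightarrow> bool" where
  "is_value_pair R \<gamma> P Pol Q V \<longleftrightarrow>
     bounded {Q h a |h a. h \<in> histories R} \<and> bounded (V ` histories R) \<and>
     (\<forall>h\<in>histories R. \<forall>a.
        Q h a = (\<Sum>x\<in>UNIV. \<Sum>r\<in>R. pmf (P h a) (x, r) * (r + \<gamma> * V (extend h a x r)))) \<and>
     (\<forall>h\<in>histories R. V h = (\<Sum>a\<in>UNIV. Q h a * pmf (Pol h) a))"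

(* Lists using a reward outside R are not histories; the value 0 there makes the
   description unique as a pair of total functions (see value_pair_ex1). *)
definition value_pair ::
  "real set \<Rightarrow> real \<Rightarrow> (('a::finite, 'o::finite) history \<Rightarrow> 'a \<Rightarrow> ('o \<times> real) pmf)
    \<Rightarrow> (('a, 'o) history \<Rightarrow> 'a pmf)
    \<Rightarrow> (('a, 'o) history \<Rightarrow> 'a \<Rightarrow> real) \<times> (('a, 'o) history \<Rightarrow> real)" where
  "value_pair R \<gamma> P Pol = (THE (Q, V). is_value_pair R \<gamma> P Pol Q V \<and>
     (\<forall>h. h \<notin> histories R \<longrightarrow> V h = 0 \<and> (\<forall>a. Q h a = 0)))"

definition Qval ::
  "real set \<Rightarrow> real \<Rightarrow> (('a::finite, 'o::finite) history \<Rightarrow> 'a \<Rightarrow> ('o \<times> real) pmf)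
    \<Rightarrow> (('a, 'o) history \<Rightarrow> 'a pmf) \<Rightarrow> ('a, 'o) history \<Rightarrow> 'a \<Rightarrow> real" where
  "Qval R \<gamma> P Pol = fst (value_pair R \<gamma> P Pol)"

definition Vval ::
  "real set \<Rightarrow> real \<Rightarrow> (('a::finite, 'o::finite) history \<Rightarrow> 'a \<Rightarrow> ('o \<times> real) pmf)
    \<Rightarrow> (('a, 'o) history \<Rightarrow> 'a pmf) \<Rightarrow> ('a, 'o) history \<Rightarrow> real" where
  "Vval R \<gamma> P Pol = snd (value_pair R \<gamma> P Pol)"


definition homomorphism ::
  "real set \<Rightarrow> (('a, 'o) history \<times> 'a \<Rightarrow> 's \<times> 'b) \<Rightarrow> (('a, 'o) history \<Rightarrow> 's) \<Rightarrow> bool" where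
  "homomorphism R \<psi> f \<longleftrightarrow>
     \<psi> ` (histories R \<times> UNIV) = UNIV \<and>
     f ` histories R = UNIV \<and>
     (\<forall>h\<in>histories R. \<forall>a. fst (\<psi> (h, a)) = f h)"

definition abs_process ::
  "(('a, 'o::finite) history \<Rightarrow> 'a \<Rightarrow> ('o \<times> real) pmf) \<Rightarrow> (('a, 'o) history \<Rightarrow> 's)
    \<Rightarrow> ('a, 'o) history \<Rightarrow> 'a \<Rightarrow> 's \<Rightarrow> real \<Rightarrow> real" where
  "abs_process P f h a s' r = (\<Sum>x\<in>{x. f (extend h a x r) = s'}. pmf (P h a) (x, r))"

definition abs_policy ::
  "(('a::finite, 'o) history \<times> 'a \<Rightarrow> 's \<times> 'b) \<Rightarrow> (('a, 'o) history \<Rightarrow> 's)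
    \<Rightarrow> (('a, 'o) history \<Rightarrow> 'a pmf) \<Rightarrow> ('a, 'o) history \<Rightarrow> 'b \<Rightarrow> real" where
  "abs_policy \<psi> f Pol h b = (\<Sum>a\<in>{a. \<psi> (h, a) = (f h, b)}. pmf (Pol h) a)"

(* The induced abstract process is an MDP, with transition kernel p. *)
definition abs_process_is_MDP ::
  "real set \<Rightarrow> (('a, 'o::finite) history \<Rightarrow> 'a \<Rightarrow> ('o \<times> real) pmf)
    \<Rightarrow> (('a, 'o) history \<times> 'a \<Rightarrow> 's \<times> 'b) \<Rightarrow> (('a, 'o) history \<Rightarrow> 's)
    \<Rightarrow> ('s \<Rightarrow> 'b \<Rightarrow> ('s \<times> real) pmf) \<Rightarrow> bool" where
  "abs_process_is_MDP R P \<psi> f p \<longleftrightarrow>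
     (\<forall>s b. set_pmf (p s b) \<subseteq> UNIV \<times> R) \<and>
     (\<forall>h\<in>histories R. \<forall>a s b. \<psi> (h, a) = (s, b) \<longrightarrow>
        (\<forall>s'. \<forall>r\<in>R. abs_process P f h a s' r = pmf (p s b) (s', r)))"


definition is_mdp_value_pair ::
  "real set \<Rightarrow> real \<Rightarrow> ('s::finite \<Rightarrow> 'b::finite \<Rightarrow> ('s \<times> real) pmf) \<Rightarrow> ('s \<Rightarrow> 'b pmf)
    \<Rightarrow> ('s \<Rightarrow> 'b \<Rightarrow> real) \<Rightarrow> ('s \<Rightarrow> real) \<Rightarrow> bool" where
  "is_mdp_value_pair R \<gamma> p \<pi> q v \<longleftrightarrow>
     (\<forall>s b. q s b = (\<Sum>s'\<in>UNIV. \<Sum>r\<in>R. pmf (p s b) (s', r) * (r + \<gamma> * v s'))) \<and>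
     (\<forall>s. v s = (\<Sum>b\<in>UNIV. q s b * pmf (\<pi> s) b))"

definition mdp_value_pair ::
  "real set \<Rightarrow> real \<Rightarrow> ('s::finite \<Rightarrow> 'b::finite \<Rightarrow> ('s \<times> real) pmf) \<Rightarrow> ('s \<Rightarrow> 'b pmf)
    \<Rightarrow> ('s \<Rightarrow> 'b \<Rightarrow> real) \<times> ('s \<Rightarrow> real)" where
  "mdp_value_pair R \<gamma> p \<pi> = (THE (q, v). is_mdp_value_pair R \<gamma> p \<pi> q v)"

definition qval ::
  "real set \<Rightarrow> real \<Rightarrow> ('s::finite \<Rightarrow> 'b::finite \<Rightarrow> ('s \<times> real) pmf) \<Rightarrow> ('s \<Rightarrow> 'b pmf)
    \<Rightarrow> 's \<Rightarrow> 'b \<Rightarrow> real" where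
  "qval R \<gamma> p \<pi> = fst (mdp_value_pair R \<gamma> p \<pi>)"

definition vval ::
  "real set \<Rightarrow> real \<Rightarrow> ('s::finite \<Rightarrow> 'b::finite \<Rightarrow> ('s \<times> real) pmf) \<Rightarrow> ('s \<Rightarrow> 'b pmf)
    \<Rightarrow> 's \<Rightarrow> real" where
  "vval R \<gamma> p \<pi> = snd (mdp_value_pair R \<gamma> p \<pi>)"


definition representative_policy ::
  "real set \<Rightarrow> (('a::finite, 'o) history \<times> 'a \<Rightarrow> 's \<times> 'b) \<Rightarrow> (('a, 'o) history \<Rightarrow> 's)
    \<Rightarrow> (('a, 'o) history \<Rightarrow> 'a pmf) \<Rightarrow> ('s \<Rightarrow> 'b pmf) \<Rightarrow> bool" where
  "representative_policy R \<psi> f Pol \<pi>R \<longleftrightarrow>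
     (\<forall>s. \<exists>h\<in>histories R. f h = s \<and> (\<forall>b. pmf (\<pi>R s) b = abs_policy \<psi> f Pol h b))"

definition representative_values ::
  "real set \<Rightarrow> (('a, 'o) history \<times> 'a \<Rightarrow> 's \<times> 'b) \<Rightarrow> (('a, 'o) history \<Rightarrow> 'a \<Rightarrow> real)
    \<Rightarrow> ('s \<Rightarrow> 'b \<Rightarrow> real) \<Rightarrow> bool" where
  "representative_values R \<psi> Q QR \<longleftrightarrow>
     (\<forall>s b. \<exists>h\<in>histories R. \<exists>a. \<psi> (h, a) = (s, b) \<and> QR s b = Q h a)"

definition eps_Pi ::
  "real set \<Rightarrow> (('a::finite, 'o) history \<times> 'a \<Rightarrow> 's \<times> 'b::finite) \<Rightarrow> (('a, 'o) history \<Rightarrow> 's)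
    \<Rightarrow> (('a, 'o) history \<Rightarrow> 'a pmf) \<Rightarrow> ('s \<Rightarrow> 'b pmf) \<Rightarrow> 's \<Rightarrow> real" where
  "eps_Pi R \<psi> f Pol \<pi>R s =
     (SUP h\<in>{h \<in> histories R. f h = s}. \<Sum>b\<in>UNIV. \<bar>pmf (\<pi>R s) b - abs_policy \<psi> f Pol h b\<bar>)"

definition eps_Q ::
  "real set \<Rightarrow> (('a, 'o) history \<times> 'a \<Rightarrow> 's \<times> 'b) \<Rightarrow> (('a, 'o) history \<Rightarrow> 'a \<Rightarrow> real)
    \<Rightarrow> ('s \<Rightarrow> 'b \<Rightarrow> real) \<Rightarrow> 's \<Rightarrow> real" where
  "eps_Q R \<psi> Q QR s =
     (SUP (h, a, b)\<in>{(h, a, b). h \<in> histories R \<and> \<psi> (h, a) = (s, b)}. \<bar>QR s b - Q h a\<bar>)"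

definition eps_max ::
  "real set \<Rightarrow> real \<Rightarrow> (('a::finite, 'o) history \<times> 'a \<Rightarrow> 's::finite \<times> 'b::finite)
    \<Rightarrow> (('a, 'o) history \<Rightarrow> 's) \<Rightarrow> (('a, 'o) history \<Rightarrow> 'a pmf) \<Rightarrow> ('s \<Rightarrow> 'b pmf)
    \<Rightarrow> (('a, 'o) history \<Rightarrow> 'a \<Rightarrow> real) \<Rightarrow> ('s \<Rightarrow> 'b \<Rightarrow> real) \<Rightarrow> real" where
  "eps_max R \<gamma> \<psi> f Pol \<pi>R Q QR =
     (MAX s. eps_Q R \<psi> Q QR s + eps_Pi R \<psi> f Pol \<pi>R s / (1 - \<gamma>))"


lemma contraction_ex1:
  fixes T :: "('x \<Rightarrow> real) \<Rightarrow> 'x \<Rightarrow> real"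
  assumes g: "0 \<le> \<gamma>" "\<gamma> < 1"
    and contr: "\<And>u w c. (\<And>x. x \<in> X \<Longrightarrow> \<bar>u x - w x\<bar> \<le> c) \<Longrightarrow> 0 \<le> c
                  \<Longrightarrow> (\<And>x. x \<in> X \<Longrightarrow> \<bar>T u x - T w x\<bar> \<le> \<gamma> * c)"
    and T0: "\<And>x. x \<in> X \<Longrightarrow> \<bar>T (\<lambda>_. 0) x\<bar> \<le> 1"
  shows "\<exists>!u. (\<forall>x\<in>X. u x = T u x) \<and> bounded (u ` X) \<and> (\<forall>x. x \<notin> X \<longrightarrow> u x = 0)"
proof -
  define it where "it n = (T ^^ n) (\<lambda>_. 0)" for n
  have it_Suc: "it (Suc n) = T (it n)" for n by (simp add: it_def)
  have step: "x \<in> X \<Longrightarrow> \<bar>it (Suc n) x - it n x\<bar> \<le> \<gamma> ^ n" for n x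
  proof (induction n arbitrary: x)
    case 0
    then show ?case using T0 by (simp add: it_def)
  next
    case (Suc n)
    show ?case
      using contr[of "it (Suc n)" "it n" "\<gamma> ^ n" x] Suc g by (simp add: it_Suc)
  qed
  have tele: "x \<in> X \<Longrightarrow> \<bar>it (n + k) x - it n x\<bar> \<le> \<gamma> ^ n / (1 - \<gamma>) - \<gamma> ^ (n + k) / (1 - \<gamma>)"
    for n k x
  proof (induction k)
    case 0
    then show ?case by simp
  next
    case (Suc k)
    have "\<gamma> ^ (n + k) / (1 - \<gamma>) - \<gamma> ^ (n + Suc k) / (1 - \<gamma>)
        = \<gamma> ^ (n + k) * (1 - \<gamma>) / (1 - \<gamma>)"
      by (simp only: diff_divide_distrib[symmetric]) (simp add: algebra_simps)
    also have "\<dots> = \<gamma> ^ (n + k)"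
      using g by simp
    finally have "\<gamma> ^ (n + k) / (1 - \<gamma>) - \<gamma> ^ (n + Suc k) / (1 - \<gamma>) = \<gamma> ^ (n + k)" .
    then show ?case
      using Suc step[of x "n + k"] by simp
  qed
  have tele': "\<bar>it (n + k) x - it n x\<bar> \<le> \<gamma> ^ n / (1 - \<gamma>)" if "x \<in> X" for n k x
  proof -
    have "0 \<le> \<gamma> ^ (n + k) / (1 - \<gamma>)" using g by simp
    then show ?thesis using tele[OF that, of n k] by linarith
  qed
  have lim0: "(\<lambda>n. \<gamma> ^ n / (1 - \<gamma>)) \<longlonglongrightarrow> 0"
    using g by (auto intro!: tendsto_eq_intros LIMSEQ_realpow_zero)
  have "convergent (\<lambda>n. it n x)" if "x \<in> X" for x
  proof -
    have "Cauchy (\<lambda>n. it n x)"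
    proof (rule CauchyI')
      fix e :: real assume "0 < e"
      then obtain N where N: "\<And>n. n \<ge> N \<Longrightarrow> \<bar>\<gamma> ^ n / (1 - \<gamma>)\<bar> < e"
        using LIMSEQ_D[OF lim0] by (auto simp del: abs_divide)
      show "\<exists>M. \<forall>m\<ge>M. \<forall>n>m. dist (it m x) (it n x) < e"
      proof (intro exI allI impI)
        fix m n assume "N \<le> m" "m < n"
        then show "dist (it m x) (it n x) < e"
          using tele'[OF that, of m "n - m"] N[of m] abs_ge_self[of "\<gamma> ^ m / (1 - \<gamma>)"]
          by (simp add: dist_real_def abs_minus_commute del: abs_divide)
      qed
    qed
    then show ?thesis by (simp add: Cauchy_convergent_iff)
  qed
  then have conv: "x \<in> X \<Longrightarrow> (\<lambda>n. it n x) \<longlonglongrightarrow> lim (\<lambda>n. it n x)" for x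
    by (simp add: convergent_LIMSEQ_iff)
  define u where "u x = (if x \<in> X then lim (\<lambda>n. it n x) else 0)" for x
  have near: "\<bar>u x - it n x\<bar> \<le> \<gamma> ^ n / (1 - \<gamma>)" if "x \<in> X" for x n
  proof (rule LIMSEQ_le_const2)
    show "(\<lambda>k. \<bar>it (k + n) x - it n x\<bar>) \<longlonglongrightarrow> \<bar>u x - it n x\<bar>"
      using LIMSEQ_ignore_initial_segment[OF conv[OF that], of n] that
      by (auto intro!: tendsto_intros simp: u_def)
    show "\<exists>N. \<forall>k\<ge>N. \<bar>it (k + n) x - it n x\<bar> \<le> \<gamma> ^ n / (1 - \<gamma>)"
      using tele'[OF that, of n] by (simp add: add.commute)
  qed
  have fix_u: "u x = T u x" if "x \<in> X" for x
  proof -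
    have "\<bar>u x - T u x\<bar> \<le> 2 * (\<gamma> ^ n / (1 - \<gamma>))" for n
    proof -
      have c0: "0 \<le> \<gamma> ^ n / (1 - \<gamma>)" using g by simp
      have "\<bar>T u x - T (it n) x\<bar> \<le> \<gamma> * (\<gamma> ^ n / (1 - \<gamma>))"
        using contr[of u "it n", OF near c0 that] by simp
      moreover have "\<bar>u x - T (it n) x\<bar> \<le> \<gamma> * (\<gamma> ^ n / (1 - \<gamma>))"
        using near[OF that, of "Suc n"] by (simp add: it_Suc)
      moreover have "\<gamma> * (\<gamma> ^ n / (1 - \<gamma>)) \<le> \<gamma> ^ n / (1 - \<gamma>)"
        using mult_right_mono[OF less_imp_le[OF g(2)] c0] by simp
      ultimately show ?thesis by linarith
    qed
    then have "\<bar>u x - T u x\<bar> \<le> 0"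
      using LIMSEQ_le_const[OF tendsto_mult_right_zero[OF lim0, of 2]] by blast
    then show ?thesis by simp
  qed
  have bd_u: "bounded (u ` X)"
    unfolding bounded_iff using near[where n=0] by (auto simp: it_def)
  show ?thesis
  proof (rule ex1I[of _ u])
    show "(\<forall>x\<in>X. u x = T u x) \<and> bounded (u ` X) \<and> (\<forall>x. x \<notin> X \<longrightarrow> u x = 0)"
      using fix_u bd_u by (auto simp: u_def)
    fix w assume w: "(\<forall>x\<in>X. w x = T w x) \<and> bounded (w ` X) \<and> (\<forall>x. x \<notin> X \<longrightarrow> w x = 0)"
    then have wX: "\<And>x. x \<in> X \<Longrightarrow> w x = T w x" and bd_w: "bounded (w ` X)"
      and w0: "\<And>x. x \<notin> X \<Longrightarrow> w x = 0" by blast+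
    obtain B1 B2 where B: "\<And>x. x \<in> X \<Longrightarrow> \<bar>u x\<bar> \<le> B1" "\<And>x. x \<in> X \<Longrightarrow> \<bar>w x\<bar> \<le> B2"
      using bd_u bd_w by (auto simp: bounded_iff)
    define C where "C = max 0 (B1 + B2)"
    have "x \<in> X \<Longrightarrow> \<bar>w x - u x\<bar> \<le> \<gamma> ^ n * C" for n x
    proof (induction n arbitrary: x)
      case 0
      then show ?case using B[of x] by (auto simp: C_def)
    next
      case (Suc n)
      have "\<bar>T w x - T u x\<bar> \<le> \<gamma> * (\<gamma> ^ n * C)"
        using contr[of w u "\<gamma> ^ n * C" x] Suc g by (simp add: C_def)
      then show ?case
        using wX[OF Suc.prems, symmetric] fix_u[OF Suc.prems, symmetric] by (simp add: mult.assoc)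
    qed
    moreover have "(\<lambda>n. \<gamma> ^ n * C) \<longlonglongrightarrow> 0"
      using g by (auto intro!: tendsto_mult_left_zero LIMSEQ_realpow_zero)
    ultimately have le: "x \<in> X \<Longrightarrow> \<bar>w x - u x\<bar> \<le> 0" for x
      using LIMSEQ_le_const by blast
    show "w = u"
    proof
      show "w x = u x" for x
        using le[of x] w0[of x] by (cases "x \<in> X") (simp_all add: u_def)
    qed
  qed
qed

lemma sum_pmf_support:
  fixes p :: "('c::finite \<times> real) pmf"
  assumes "finite R" "set_pmf p \<subseteq> UNIV \<times> R"
  shows "(\<Sum>x\<in>UNIV. \<Sum>r\<in>R. pmf p (x, r)) = 1"
  using sum_pmf_eq_1[of "UNIV \<times> R" p] assms by (simp add: sum.cartesian_product)

lemma backup_bounds: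
  fixes p :: "('c::finite \<times> real) pmf"
  assumes R: "finite R" "R \<subseteq> {0..1}" and p: "set_pmf p \<subseteq> UNIV \<times> R" and g: "0 \<le> \<gamma>"
  shows "(\<And>x r. r \<in> R \<Longrightarrow> \<bar>u x r - w x r\<bar> \<le> c) \<Longrightarrow>
      \<bar>(\<Sum>x\<in>UNIV. \<Sum>r\<in>R. pmf p (x, r) * (r + \<gamma> * u x r))
        - (\<Sum>x\<in>UNIV. \<Sum>r\<in>R. pmf p (x, r) * (r + \<gamma> * w x r))\<bar> \<le> \<gamma> * c"
    and "(\<And>x r. r \<in> R \<Longrightarrow> \<bar>u x r\<bar> \<le> B) \<Longrightarrow>
      \<bar>\<Sum>x\<in>UNIV. \<Sum>r\<in>R. pmf p (x, r) * (r + \<gamma> * u x r)\<bar> \<le> 1 + \<gamma> * B"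
proof -
  have avg: "\<bar>\<Sum>x\<in>UNIV. \<Sum>r\<in>R. pmf p (x, r) * t x r\<bar> \<le> d"
    if "\<And>x r. r \<in> R \<Longrightarrow> \<bar>t x r\<bar> \<le> d" for t :: "'c \<Rightarrow> real \<Rightarrow> real" and d
  proof -
    have "\<bar>\<Sum>x\<in>UNIV. \<Sum>r\<in>R. pmf p (x, r) * t x r\<bar> \<le> (\<Sum>x\<in>UNIV. \<Sum>r\<in>R. pmf p (x, r) * d)"
      by (intro order_trans[OF sum_abs] sum_mono)
        (auto simp: abs_mult intro!: mult_left_mono that)
    also have "\<dots> = d"
      by (simp flip: sum_distrib_right add: sum_pmf_support[OF R(1) p])
    finally show ?thesis .
  qed
  {
    assume uw: "\<And>x r. r \<in> R \<Longrightarrow> \<bar>u x r - w x r\<bar> \<le> c"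
    have "\<bar>\<gamma> * (u x r - w x r)\<bar> \<le> \<gamma> * c" if "r \<in> R" for x r
      using uw[OF that] g by (simp add: abs_mult mult_left_mono)
    then have "\<bar>\<Sum>x\<in>UNIV. \<Sum>r\<in>R. pmf p (x, r) * (\<gamma> * (u x r - w x r))\<bar> \<le> \<gamma> * c"
      by (rule avg)
    then show "\<bar>(\<Sum>x\<in>UNIV. \<Sum>r\<in>R. pmf p (x, r) * (r + \<gamma> * u x r))
        - (\<Sum>x\<in>UNIV. \<Sum>r\<in>R. pmf p (x, r) * (r + \<gamma> * w x r))\<bar> \<le> \<gamma> * c"
      by (simp flip: sum_subtractf add: algebra_simps)
  }
  assume u: "\<And>x r. r \<in> R \<Longrightarrow> \<bar>u x r\<bar> \<le> B"
  have "\<bar>r + \<gamma> * u x r\<bar> \<le> 1 + \<gamma> * B" if "r \<in> R" for x r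
  proof -
    have "\<bar>\<gamma> * u x r\<bar> \<le> \<gamma> * B" using u[OF that] g by (simp add: abs_mult mult_left_mono)
    then show ?thesis using that R(2) by (force intro: order_trans[OF abs_triangle_ineq])
  qed
  then show "\<bar>\<Sum>x\<in>UNIV. \<Sum>r\<in>R. pmf p (x, r) * (r + \<gamma> * u x r)\<bar> \<le> 1 + \<gamma> * B"
    by (rule avg)
qed

lemma policy_avg:
  fixes \<pi> :: "'c::finite pmf"
  assumes "\<And>a. \<bar>t a\<bar> \<le> d"
  shows "\<bar>\<Sum>a\<in>UNIV. t a * pmf \<pi> a\<bar> \<le> d"
proof -
  have "\<bar>\<Sum>a\<in>UNIV. t a * pmf \<pi> a\<bar> \<le> (\<Sum>a\<in>UNIV. d * pmf \<pi> a)"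
    by (intro order_trans[OF sum_abs] sum_mono)
      (auto simp: abs_mult intro!: mult_right_mono assms)
  also have "\<dots> = d"
    using sum_pmf_eq_1[of UNIV \<pi>] by (simp flip: sum_distrib_left)
  finally show ?thesis .
qed

lemma policy_avg_diff:
  fixes \<pi> :: "'c::finite pmf"
  assumes "\<And>a. \<bar>t a - t' a\<bar> \<le> d"
  shows "\<bar>(\<Sum>a\<in>UNIV. t a * pmf \<pi> a) - (\<Sum>a\<in>UNIV. t' a * pmf \<pi> a)\<bar> \<le> d"
  using policy_avg[of "\<lambda>a. t a - t' a" d \<pi>] assms
  by (simp add: left_diff_distrib sum_subtractf)

lemma extend_in_histories: "h \<in> histories R \<Longrightarrow> r \<in> R \<Longrightarrow> extend h a x r \<in> histories R"
  by (auto simp: histories_def extend_def)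

lemma value_pair_ex1:
  fixes P :: "('a::finite, 'o::finite) history \<Rightarrow> 'a \<Rightarrow> ('o \<times> real) pmf"
  assumes R: "finite R" "R \<subseteq> {0..1}" and g: "0 \<le> \<gamma>" "\<gamma> < 1" and P: "history_process R P"
  shows "\<exists>!(Q, V). is_value_pair R \<gamma> P Pol Q V \<and>
     (\<forall>h. h \<notin> histories R \<longrightarrow> V h = 0 \<and> (\<forall>a. Q h a = 0))"
proof -
  define F where "F V h a =
    (\<Sum>x\<in>UNIV. \<Sum>r\<in>R. pmf (P h a) (x, r) * (r + \<gamma> * V (extend h a x r)))"
    for V :: "('a, 'o) history \<Rightarrow> real" and h a
  define T where "T V h = (\<Sum>a\<in>UNIV. F V h a * pmf (Pol h) a)" for V h
  have supp: "h \<in> histories R \<Longrightarrow> set_pmf (P h a) \<subseteq> UNIV \<times> R" for h a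
    using P by (auto simp: history_process_def)
  have Fdiff: "\<bar>F u h a - F w h a\<bar> \<le> \<gamma> * c"
    if "\<And>x. x \<in> histories R \<Longrightarrow> \<bar>u x - w x\<bar> \<le> c" "h \<in> histories R" for u w c h a
    unfolding F_def
    by (rule backup_bounds(1)[OF R supp g(1)]) (auto intro!: that extend_in_histories)
  have Fbd: "\<bar>F u h a\<bar> \<le> 1 + \<gamma> * B"
    if "\<And>x. x \<in> histories R \<Longrightarrow> \<bar>u x\<bar> \<le> B" "h \<in> histories R" for u B h a
    unfolding F_def
    by (rule backup_bounds(2)[OF R supp g(1)]) (auto intro!: that extend_in_histories)
  have ex1: "\<exists>!u. (\<forall>x\<in>histories R. u x = T u x) \<and> bounded (u ` histories R)
     \<and> (\<forall>x. x \<notin> histories R \<longrightarrow> u x = 0)"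
  proof (rule contraction_ex1[OF g])
    show "\<bar>T u h - T w h\<bar> \<le> \<gamma> * c"
      if "\<And>x. x \<in> histories R \<Longrightarrow> \<bar>u x - w x\<bar> \<le> c" "h \<in> histories R" for u w c h
      unfolding T_def by (rule policy_avg_diff) (rule Fdiff[OF that])
    show "\<bar>T (\<lambda>_. 0) h\<bar> \<le> 1" if "h \<in> histories R" for h
      unfolding T_def by (rule policy_avg) (use Fbd[of "\<lambda>_. 0" 0 h] that in auto)
  qed
  define G where "G V h a = (if h \<in> histories R then F V h a else 0)" for V h a
  have iff: "(is_value_pair R \<gamma> P Pol Q V \<and>
     (\<forall>h. h \<notin> histories R \<longrightarrow> V h = 0 \<and> (\<forall>a. Q h a = 0))) \<longleftrightarrow>
     Q = G V \<and> (\<forall>x\<in>histories R. V x = T V x) \<and> bounded (V ` histories R)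
     \<and> (\<forall>x. x \<notin> histories R \<longrightarrow> V x = 0)" (is "?L \<longleftrightarrow> ?R") for Q V
  proof
    assume l: ?L
    have QG: "Q = G V"
      by (intro ext) (use l in \<open>simp add: is_value_pair_def G_def F_def\<close>)
    have "V x = T V x" if "x \<in> histories R" for x
    proof -
      have "V x = (\<Sum>a\<in>UNIV. Q x a * pmf (Pol x) a)"
        using l that by (simp only: is_value_pair_def)
      also have "\<dots> = T V x"
        using that by (simp add: QG G_def T_def)
      finally show ?thesis .
    qed
    moreover have "bounded (V ` histories R)" "\<forall>x. x \<notin> histories R \<longrightarrow> V x = 0"
      using l unfolding is_value_pair_def by blast+
    ultimately show ?R
      using QG by blast
  next
    assume r: ?R
    then have "bounded (V ` histories R)" by blast
    then obtain B where "\<And>x. x \<in> histories R \<Longrightarrow> \<bar>V x\<bar> \<le> B" by (auto simp: bounded_iff)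
    then have "\<forall>h\<in>histories R. \<forall>a. \<bar>F V h a\<bar> \<le> 1 + \<gamma> * B"
      using Fbd by blast
    moreover have QF: "\<forall>h\<in>histories R. \<forall>a. Q h a = F V h a"
      using r by (simp add: G_def)
    ultimately have "bounded {Q h a |h a. h \<in> histories R}"
      unfolding bounded_iff by (intro exI[of _ "1 + \<gamma> * B"]) auto
    moreover have "V h = (\<Sum>a\<in>UNIV. Q h a * pmf (Pol h) a)" if "h \<in> histories R" for h
    proof -
      have "V h = T V h" using r that by blast
      also have "\<dots> = (\<Sum>a\<in>UNIV. Q h a * pmf (Pol h) a)"
        using QF that by (simp add: T_def)
      finally show ?thesis .
    qed
    moreover have "\<forall>h. h \<notin> histories R \<longrightarrow> V h = 0 \<and> (\<forall>a. Q h a = 0)"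
      using r by (simp add: G_def)
    ultimately show ?L
      using r QF unfolding is_value_pair_def F_def by blast
  qed
  from ex1 obtain V where V: "(\<forall>x\<in>histories R. V x = T V x) \<and> bounded (V ` histories R)
     \<and> (\<forall>x. x \<notin> histories R \<longrightarrow> V x = 0)" by blast
  show ?thesis
  proof (rule ex1I[of _ "(G V, V)"])
    show "case (G V, V) of (Q, V) \<Rightarrow> is_value_pair R \<gamma> P Pol Q V \<and>
     (\<forall>h. h \<notin> histories R \<longrightarrow> V h = 0 \<and> (\<forall>a. Q h a = 0))"
      unfolding prod.case by (rule iff[THEN iffD2]) (use V in blast)
    show "y = (G V, V)" if "case y of (Q, V) \<Rightarrow> is_value_pair R \<gamma> P Pol Q V \<and>
     (\<forall>h. h \<notin> histories R \<longrightarrow> V h = 0 \<and> (\<forall>a. Q h a = 0))" for y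
    proof (cases y)
      case (Pair Q' V')
      from that have "Q' = G V' \<and> (\<forall>x\<in>histories R. V' x = T V' x)
          \<and> bounded (V' ` histories R) \<and> (\<forall>x. x \<notin> histories R \<longrightarrow> V' x = 0)"
        unfolding Pair prod.case by (rule iff[THEN iffD1])
      with ex1 V have "V' = V" "Q' = G V'" by blast+
      then show ?thesis using Pair by simp
    qed
  qed
qed

lemma mdp_value_pair_ex1:
  fixes p :: "'s::finite \<Rightarrow> 'b::finite \<Rightarrow> ('s \<times> real) pmf"
  assumes R: "finite R" "R \<subseteq> {0..1}" and g: "0 \<le> \<gamma>" "\<gamma> < 1"
    and p: "\<And>s b. set_pmf (p s b) \<subseteq> UNIV \<times> R"
  shows "\<exists>!(q, v). is_mdp_value_pair R \<gamma> p \<pi> q v"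
proof -
  define F where "F v s b = (\<Sum>s'\<in>UNIV. \<Sum>r\<in>R. pmf (p s b) (s', r) * (r + \<gamma> * v s'))"
    for v :: "'s \<Rightarrow> real" and s b
  define T where "T v s = (\<Sum>b\<in>UNIV. F v s b * pmf (\<pi> s) b)" for v s
  have "\<exists>!u. (\<forall>x\<in>UNIV. u x = T u x) \<and> bounded (u ` UNIV) \<and> (\<forall>x. x \<notin> UNIV \<longrightarrow> u x = 0)"
  proof (rule contraction_ex1[OF g])
    show "\<bar>T u s - T w s\<bar> \<le> \<gamma> * c" if "\<And>x. x \<in> UNIV \<Longrightarrow> \<bar>u x - w x\<bar> \<le> c" for u w c s
      unfolding T_def
    proof (rule policy_avg_diff)
      show "\<bar>F u s b - F w s b\<bar> \<le> \<gamma> * c" for b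
        unfolding F_def by (rule backup_bounds(1)[OF R p g(1)]) (use that in auto)
    qed
    show "\<bar>T (\<lambda>_. 0) s\<bar> \<le> 1" for s
      unfolding T_def
    proof (rule policy_avg)
      show "\<bar>F (\<lambda>_. 0) s b\<bar> \<le> 1" for b
        unfolding F_def
        using backup_bounds(2)[OF R p g(1), where u = "\<lambda>_ _. 0" and B = 0] by simp
    qed
  qed
  then have ex1: "\<exists>!u. \<forall>x. u x = T u x" by (simp add: finite_imp_bounded)
  then obtain v where v: "\<forall>x. v x = T v x" by blast
  have iff: "is_mdp_value_pair R \<gamma> p \<pi> q v' \<longleftrightarrow> q = F v' \<and> (\<forall>x. v' x = T v' x)" for q v'
  proof -
    have "is_mdp_value_pair R \<gamma> p \<pi> q v' \<longleftrightarrow>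
        q = F v' \<and> (\<forall>s. v' s = (\<Sum>b\<in>UNIV. q s b * pmf (\<pi> s) b))"
      unfolding is_mdp_value_pair_def F_def by (simp only: fun_eq_iff)
    then show ?thesis unfolding T_def by blast
  qed
  show ?thesis
  proof (rule ex1I[of _ "(F v, v)"])
    show "case (F v, v) of (q, v) \<Rightarrow> is_mdp_value_pair R \<gamma> p \<pi> q v"
      unfolding prod.case by (rule iff[THEN iffD2]) (use v in blast)
    show "y = (F v, v)" if "case y of (q, v) \<Rightarrow> is_mdp_value_pair R \<gamma> p \<pi> q v" for y
    proof (cases y)
      case (Pair q' v')
      from that have "q' = F v' \<and> (\<forall>x. v' x = T v' x)"
        unfolding Pair prod.case by (rule iff[THEN iffD1])
      with ex1 v have "v' = v" "q' = F v'" by blast+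
      then show ?thesis using Pair by simp
    qed
  qed
qed

end

theory Submission
  imports Defs
begin

text \<open>
  Every backup over the abstract MDP is a backup over the original process with \<open>v\<close> pulled back
  along \<open>f\<close>. Hence a uniform bound \<open>D\<close> on \<open>v (f h) - V h\<close> gives
  \<open>\<bar>q s b - Q h a\<bar> \<le> \<gamma> D\<close>. Conversely, one splits \<open>v (f h) - V h\<close> through \<open>QR\<close> into
  \<open>\<Sum>b. \<pi>R b (q b - QR b)\<close>, bounded by \<open>\<gamma> D\<close> because \<open>QR\<close> consists of values of \<open>Q\<close>,
  \<open>\<Sum>b. QR b (\<pi>R b - \<Pi>\<^sub>\<psi> b)\<close>, bounded by \<open>\<epsilon>\<^sub>\<Pi> / (1 - \<gamma>)\<close> because \<open>\<bar>Q\<bar> \<le> 1 / (1 - \<gamma>)\<close>, and an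
  error of at most \<open>\<epsilon>\<^sub>Q\<close>. So \<open>D\<close> improves to \<open>\<epsilon>\<^sub>m\<^sub>a\<^sub>x + \<gamma> D\<close>, and for the least \<open>D\<close> this
  gives \<open>D \<le> \<epsilon>\<^sub>m\<^sub>a\<^sub>x / (1 - \<gamma>)\<close>.
\<close>

text \<open>Boundedness gives a least uniform bound D, and \<open>step\<close> applied to it yields
  D \<le> c + \<gamma> D. Used with c = 1 for the values themselves and with c =
  \<open>eps_max\<close> for the difference of abstract and original values.\<close>

lemma contraction_bound:
  fixes g :: "'x \<Rightarrow> real"
  assumes "bounded (g ` X)" and "\<gamma> < 1"
    and step: "\<And>D x. (\<And>y. y \<in> X \<Longrightarrow> \<bar>g y\<bar> \<le> D) \<Longrightarrow> x \<in> X \<Longrightarrow> \<bar>g x\<bar> \<le> c + \<gamma> * D"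
    and "x \<in> X"
  shows "\<bar>g x\<bar> \<le> c / (1 - \<gamma>)"
proof -
  define D where "D = (SUP y\<in>X. \<bar>g y\<bar>)"
  have bdd: "bdd_above ((\<lambda>y. \<bar>g y\<bar>) ` X)"
    using assms(1) by (auto simp: bounded_iff bdd_above_def)
  have le: "\<bar>g y\<bar> \<le> D" if "y \<in> X" for y
    unfolding D_def by (rule cSUP_upper[OF that bdd])
  \<comment> \<open>The point x makes the index set nonempty, as a supremum bound requires.\<close>
  have "(SUP y\<in>X. \<bar>g y\<bar>) \<le> c + \<gamma> * D"
    by (rule cSUP_least) (use step[OF le] \<open>x \<in> X\<close> in auto)
  then have "D \<le> c + \<gamma> * D"
    by (simp only: D_def)
  then have "D \<le> c / (1 - \<gamma>)"
    using \<open>\<gamma> < 1\<close> by (simp add: field_simps)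
  then show ?thesis
    using le[OF \<open>x \<in> X\<close>] by linarith
qed

lemma is_value_pair_vals:
  assumes "finite R" "R \<subseteq> {0..1}" "0 \<le> \<gamma>" "\<gamma> < 1" "history_process R P"
  shows "is_value_pair R \<gamma> P Pol (Qval R \<gamma> P Pol) (Vval R \<gamma> P Pol)"
  using theI'[OF value_pair_ex1[OF assms, of Pol]]
  unfolding Qval_def Vval_def value_pair_def by (simp add: split_beta')

lemma is_mdp_value_pair_vals:
  assumes "finite R" "R \<subseteq> {0..1}" "0 \<le> \<gamma>" "\<gamma> < 1"
    and "\<And>s b. set_pmf (p s b) \<subseteq> UNIV \<times> R"
  shows "is_mdp_value_pair R \<gamma> p \<pi> (qval R \<gamma> p \<pi>) (vval R \<gamma> p \<pi>)"
  using theI'[OF mdp_value_pair_ex1[where p = p and \<pi> = \<pi>, OF assms]]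
  unfolding qval_def vval_def mdp_value_pair_def by (simp add: split_beta')

text \<open>Rewards lie in [0,1], so a backup sends the bound B to 1 + \<gamma> B. The result is the
  factor of \<open>eps_Pi\<close> in \<open>eps_max\<close> and also bounds the set whose supremum
  is \<open>eps_Q\<close>.\<close>

lemma value_pair_bound:
  assumes R: "finite R" "R \<subseteq> {0..1}" and g: "0 \<le> \<gamma>" "\<gamma> < 1" and P: "history_process R P"
    and QV: "is_value_pair R \<gamma> P Pol Q V" and h: "h \<in> histories R"
  shows "\<bar>Q h a\<bar> \<le> 1 / (1 - \<gamma>)"
proof -
  have Q: "\<bar>Q h a\<bar> \<le> 1 + \<gamma> * B"
    if "\<And>h. h \<in> histories R \<Longrightarrow> \<bar>V h\<bar> \<le> B" "h \<in> histories R" for B h a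
  proof -
    have supp: "set_pmf (P h a) \<subseteq> UNIV \<times> R"
      using P that(2) by (auto simp: history_process_def)
    have "Q h a = (\<Sum>x\<in>UNIV. \<Sum>r\<in>R. pmf (P h a) (x, r) * (r + \<gamma> * V (extend h a x r)))"
      using QV that(2) unfolding is_value_pair_def by blast
    then show ?thesis
      using backup_bounds(2)[OF R supp g(1), of "\<lambda>x r. V (extend h a x r)" B] that
      by (simp add: extend_in_histories)
  qed
  have V: "\<bar>V h\<bar> \<le> 1 / (1 - \<gamma>)" if "h \<in> histories R" for h
  proof (rule contraction_bound[OF _ g(2) _ that])
    show "bounded (V ` histories R)"
      using QV unfolding is_value_pair_def by blast
    show "\<bar>V h\<bar> \<le> 1 + \<gamma> * B"
      if "\<And>h. h \<in> histories R \<Longrightarrow> \<bar>V h\<bar> \<le> B" "h \<in> histories R" for B h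
    proof -
      have "V h = (\<Sum>a\<in>UNIV. Q h a * pmf (Pol h) a)"
        using QV that(2) unfolding is_value_pair_def by blast
      then show ?thesis
        using policy_avg[of "Q h" _ "Pol h"] Q[OF that] by simp
    qed
  qed
  \<comment> \<open>The bound on V is the fixed point of B -> 1 + \<gamma> B, so one more backup
    transfers it unchanged to Q.\<close>
  have "1 + \<gamma> * (1 / (1 - \<gamma>)) = 1 / (1 - \<gamma>)"
    using g by (simp add: field_simps)
  then show ?thesis
    using Q[OF V h] by simp
qed

text \<open>For each fixed r, the observations are partitioned by the abstract state they lead to.
  The partition depends on r, so the sums are swapped before regrouping.\<close>

lemma abs_process_sum:
  fixes f :: "('a, 'o::finite) history \<Rightarrow> 's::finite"
  shows "(\<Sum>s'\<in>UNIV. \<Sum>r\<in>R. abs_process P f h a s' r * t s' r)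
    = (\<Sum>x\<in>UNIV. \<Sum>r\<in>R. pmf (P h a) (x, r) * t (f (extend h a x r)) r)"
proof -
  have "(\<Sum>s'\<in>UNIV. abs_process P f h a s' r * t s' r)
    = (\<Sum>x\<in>UNIV. pmf (P h a) (x, r) * t (f (extend h a x r)) r)" for r
    using sum.group[of UNIV UNIV "\<lambda>x. f (extend h a x r)"
        "\<lambda>x. pmf (P h a) (x, r) * t (f (extend h a x r)) r"]
    by (simp add: abs_process_def sum_distrib_right)
  then show ?thesis
    by (simp only: sum.swap[of _ R UNIV])
qed

text \<open>The fibres of the abstract-action component at h partition the actions. This lets
  representative values be compared with Q action by action.\<close>

lemma abs_policy_sum:
  fixes \<psi> :: "('a::finite, 'o) history \<times> 'a \<Rightarrow> 's \<times> 'b::finite"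
  assumes "\<And>a. fst (\<psi> (h, a)) = f h"
  shows "(\<Sum>b\<in>UNIV. t b * abs_policy \<psi> f Pol h b)
    = (\<Sum>a\<in>UNIV. t (snd (\<psi> (h, a))) * pmf (Pol h) a)"
proof -
  have "{a. \<psi> (h, a) = (f h, b)} = {a. snd (\<psi> (h, a)) = b}" for b
    using assms by (auto simp: prod_eq_iff)
  then show ?thesis
    using sum.group[of UNIV UNIV "\<lambda>a. snd (\<psi> (h, a))"
        "\<lambda>a. t (snd (\<psi> (h, a))) * pmf (Pol h) a"]
    by (simp add: abs_policy_def sum_distrib_left)
qed

lemma abs_policy_bounds:
  "0 \<le> abs_policy \<psi> f Pol h b" "abs_policy \<psi> f Pol h b \<le> 1"
proof -
  show "0 \<le> abs_policy \<psi> f Pol h b"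
    by (simp add: abs_policy_def sum_nonneg)
  have "abs_policy \<psi> f Pol h b = measure (Pol h) {a. \<psi> (h, a) = (f h, b)}"
    by (simp add: abs_policy_def measure_measure_pmf_finite)
  then show "abs_policy \<psi> f Pol h b \<le> 1"
    by simp
qed

lemma eps_Pi_upper:
  fixes \<psi> :: "('a::finite, 'o) history \<times> 'a \<Rightarrow> 's \<times> 'b::finite"
  assumes "h \<in> histories R"
  shows "(\<Sum>b\<in>UNIV. \<bar>pmf (\<pi>R (f h)) b - abs_policy \<psi> f Pol h b\<bar>) \<le> eps_Pi R \<psi> f Pol \<pi>R (f h)"
  unfolding eps_Pi_def
proof (rule cSUP_upper)
  have "\<bar>pmf (\<pi>R (f h)) b - abs_policy \<psi> f Pol h' b\<bar> \<le> 1" for b h'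
    using abs_policy_bounds[of \<psi> f Pol h' b] pmf_le_1[of "\<pi>R (f h)" b]
      pmf_nonneg[of "\<pi>R (f h)" b] by linarith
  then show "bdd_above ((\<lambda>h'. \<Sum>b\<in>UNIV. \<bar>pmf (\<pi>R (f h)) b - abs_policy \<psi> f Pol h' b\<bar>) `
      {h' \<in> histories R. f h' = f h})"
    \<comment> \<open>Each summand is at most 1, so the number of abstract actions bounds the sum
      for all histories.\<close>
    by (intro bdd_aboveI2[where M = "\<Sum>b\<in>(UNIV :: 'b set). 1"] sum_mono)
qed (use assms in simp)

lemma eps_Q_upper:
  fixes \<psi> :: "('a, 'o) history \<times> 'a \<Rightarrow> 's \<times> 'b::finite"
  assumes bd: "\<And>h a. h \<in> histories R \<Longrightarrow> \<bar>Q h a\<bar> \<le> B"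
    and "h \<in> histories R" "\<psi> (h, a) = (s, b)"
  shows "\<bar>QR s b - Q h a\<bar> \<le> eps_Q R \<psi> Q QR s"
proof -
  let ?A = "{(h, a, b). h \<in> histories R \<and> \<psi> (h, a) = (s, b)}"
  have "bdd_above ((\<lambda>(h, a, b). \<bar>QR s b - Q h a\<bar>) ` ?A)"
  proof (rule bdd_aboveI2)
    fix x assume "x \<in> ?A"
    \<comment> \<open>The finite sum dominates every \<open>QR s b\<close>, which makes the bound
      independent of b.\<close>
    then show "(case x of (h, a, b) \<Rightarrow> \<bar>QR s b - Q h a\<bar>) \<le> (\<Sum>b\<in>UNIV. \<bar>QR s b\<bar>) + B"
    proof clarify
      fix h :: "('a, 'o) history" and a :: 'a and b :: 'b
      assume "h \<in> histories R"
      then have "\<bar>Q h a\<bar> \<le> B" by (rule bd)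
      moreover have "\<bar>QR s b\<bar> \<le> (\<Sum>b\<in>UNIV. \<bar>QR s b\<bar>)"
        by (rule member_le_sum) auto
      ultimately show "\<bar>QR s b - Q h a\<bar> \<le> (\<Sum>b\<in>UNIV. \<bar>QR s b\<bar>) + B"
        by linarith
    qed
  qed
  from cSUP_upper[OF _ this, of "(h, a, b)"] assms(2,3) show ?thesis
    by (simp add: eps_Q_def)
qed

text \<open>Triangle inequality through the averages of c under \<pi> and under the induced policy.
  The change of policy between these two is estimated by pairing the sup norm of c with the l1
  distance.\<close>

lemma policy_value_diff:
  fixes \<psi> :: "('a::finite, 'o) history \<times> 'a \<Rightarrow> 's \<times> 'b::finite"
  assumes \<psi>: "\<And>a. fst (\<psi> (h, a)) = f h"
    and qc: "\<And>b. \<bar>q b - c b\<bar> \<le> d" and cQ: "\<And>a. \<bar>c (snd (\<psi> (h, a))) - Q a\<bar> \<le> e"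
    and cB: "\<And>b. \<bar>c b\<bar> \<le> B"
  shows "\<bar>(\<Sum>b\<in>UNIV. q b * pmf \<pi> b) - (\<Sum>a\<in>UNIV. Q a * pmf (Pol h) a)\<bar>
    \<le> d + B * (\<Sum>b\<in>UNIV. \<bar>pmf \<pi> b - abs_policy \<psi> f Pol h b\<bar>) + e"
proof -
  have "\<bar>(\<Sum>b\<in>UNIV. q b * pmf \<pi> b) - (\<Sum>b\<in>UNIV. c b * pmf \<pi> b)\<bar> \<le> d"
    by (rule policy_avg_diff) (rule qc)
  moreover have "\<bar>(\<Sum>b\<in>UNIV. c b * abs_policy \<psi> f Pol h b) - (\<Sum>a\<in>UNIV. Q a * pmf (Pol h) a)\<bar> \<le> e"
    unfolding abs_policy_sum[of \<psi> h f, OF \<psi>] by (rule policy_avg_diff) (rule cQ)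
  moreover have "\<bar>(\<Sum>b\<in>UNIV. c b * pmf \<pi> b) - (\<Sum>b\<in>UNIV. c b * abs_policy \<psi> f Pol h b)\<bar>
      \<le> B * (\<Sum>b\<in>UNIV. \<bar>pmf \<pi> b - abs_policy \<psi> f Pol h b\<bar>)"
    unfolding sum_subtractf[symmetric] right_diff_distrib[symmetric] sum_distrib_left
    by (intro order_trans[OF sum_abs] sum_mono) (simp add: abs_mult cB mult_right_mono)
  ultimately show ?thesis
    by linarith
qed

theorem theorem4:
  fixes R :: "real set" and \<gamma> :: real
    and P :: "('a::finite, 'o::finite) history \<Rightarrow> 'a \<Rightarrow> ('o \<times> real) pmf"
    and Pol :: "('a, 'o) history \<Rightarrow> 'a pmf"
    and \<psi> :: "('a, 'o) history \<times> 'a \<Rightarrow> 's::finite \<times> 'b::finite"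
    and f :: "('a, 'o) history \<Rightarrow> 's"
    and p :: "'s \<Rightarrow> 'b \<Rightarrow> ('s \<times> real) pmf"
    and \<pi>R :: "'s \<Rightarrow> 'b pmf"
    and QR :: "'s \<Rightarrow> 'b \<Rightarrow> real"
    and h :: "('a, 'o) history" and a :: 'a and s :: 's and b :: 'b
  assumes "finite R" and "R \<noteq> {}" and "R \<subseteq> {0..1}"
    and "0 \<le> \<gamma>" and "\<gamma> < 1"
    and "history_process R P"
    and "homomorphism R \<psi> f"
    and "abs_process_is_MDP R P \<psi> f p"
    and "representative_policy R \<psi> f Pol \<pi>R"
    and "representative_values R \<psi> (Qval R \<gamma> P Pol) QR"
    and "h \<in> histories R" and "\<psi> (h, a) = (s, b)"
  shows "\<bar>qval R \<gamma> p \<pi>R s b - Qval R \<gamma> P Pol h a\<bar>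
           \<le> \<gamma> * eps_max R \<gamma> \<psi> f Pol \<pi>R (Qval R \<gamma> P Pol) QR / (1 - \<gamma>)
       \<and> \<bar>vval R \<gamma> p \<pi>R s - Vval R \<gamma> P Pol h\<bar>
           \<le> eps_max R \<gamma> \<psi> f Pol \<pi>R (Qval R \<gamma> P Pol) QR / (1 - \<gamma>)"
proof -
  note R = \<open>finite R\<close> \<open>R \<subseteq> {0..1}\<close> and g = \<open>0 \<le> \<gamma>\<close> \<open>\<gamma> < 1\<close> and P = \<open>history_process R P\<close>
  define Q V q v where "Q = Qval R \<gamma> P Pol" and "V = Vval R \<gamma> P Pol"
    and "q = qval R \<gamma> p \<pi>R" and "v = vval R \<gamma> p \<pi>R"
  define E where "E = eps_max R \<gamma> \<psi> f Pol \<pi>R Q QR"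
  have QV: "is_value_pair R \<gamma> P Pol Q V"
    unfolding Q_def V_def by (rule is_value_pair_vals[OF R g P])
  have supp: "set_pmf (p s b) \<subseteq> UNIV \<times> R" for s b
    using assms(8) by (simp add: abs_process_is_MDP_def)
  have qv: "is_mdp_value_pair R \<gamma> p \<pi>R q v"
    unfolding q_def v_def by (rule is_mdp_value_pair_vals[OF R g supp])
  have Qbd: "\<bar>Q h a\<bar> \<le> 1 / (1 - \<gamma>)" if "h \<in> histories R" for h a
    by (rule value_pair_bound[OF R g P QV that])
  have state: "fst (\<psi> (h, a)) = f h" if "h \<in> histories R" for h a
    using assms(7) that by (simp add: homomorphism_def)
  have q_le: "\<bar>q s b - Q h a\<bar> \<le> \<gamma> * D"
    if D: "\<And>h. h \<in> histories R \<Longrightarrow> \<bar>v (f h) - V h\<bar> \<le> D"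
      and h: "h \<in> histories R" and "\<psi> (h, a) = (s, b)" for D h a s b
  proof -
    have Psupp: "set_pmf (P h a) \<subseteq> UNIV \<times> R"
      using P h by (auto simp: history_process_def)
    have "q s b = (\<Sum>s'\<in>UNIV. \<Sum>r\<in>R. pmf (p s b) (s', r) * (r + \<gamma> * v s'))"
      using qv unfolding is_mdp_value_pair_def by blast
    also have "\<dots> = (\<Sum>s'\<in>UNIV. \<Sum>r\<in>R. abs_process P f h a s' r * (r + \<gamma> * v s'))"
    proof -
      \<comment> \<open>The MDP property enters here, for the rewards over which the sum
        ranges.\<close>
      have "pmf (p s b) (s', r) = abs_process P f h a s' r" if "r \<in> R" for s' r
        using assms(8) h \<open>\<psi> (h, a) = (s, b)\<close> that
        unfolding abs_process_is_MDP_def by metis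
      then show ?thesis by simp
    qed
    also have "\<dots> = (\<Sum>x\<in>UNIV. \<Sum>r\<in>R. pmf (P h a) (x, r) * (r + \<gamma> * v (f (extend h a x r))))"
      by (rule abs_process_sum)
    finally have "q s b = \<dots>" .
    moreover have "Q h a = (\<Sum>x\<in>UNIV. \<Sum>r\<in>R. pmf (P h a) (x, r) * (r + \<gamma> * V (extend h a x r)))"
      using QV h unfolding is_value_pair_def by blast
    \<comment> \<open>Both sides are now backups under the same \<open>P h a\<close>: rewards cancel
      and only the discounted value difference remains.\<close>
    ultimately show ?thesis
      using backup_bounds(1)[OF R Psupp g(1), of "\<lambda>x r. v (f (extend h a x r))"
          "\<lambda>x r. V (extend h a x r)" D, OF D[OF extend_in_histories[OF h]]] by (simp only:)
  qed
  have v_le: "\<bar>v (f h) - V h\<bar> \<le> E / (1 - \<gamma>)" if "h \<in> histories R" for h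
  proof (rule contraction_bound[where g = "\<lambda>h. v (f h) - V h", OF _ g(2) _ that])
    have "bounded (range v)" "bounded (V ` histories R)"
      using QV unfolding is_value_pair_def by (blast intro: finite_imp_bounded finite)+
    then have "bounded ((\<lambda>h. v (f h)) ` histories R)" "bounded (V ` histories R)"
      by (auto elim: bounded_subset)
    then show "bounded ((\<lambda>h. v (f h) - V h) ` histories R)"
      by (rule bounded_minus_comp)
  next
    fix D and h :: "('a, 'o) history"
    assume D: "\<And>h. h \<in> histories R \<Longrightarrow> \<bar>v (f h) - V h\<bar> \<le> D" and h: "h \<in> histories R"
    \<comment> \<open>The representative may come from a history other than h; D is uniform over
      histories, so \<open>q_le\<close> applies there too.\<close>
    have QR: "\<exists>h'\<in>histories R. \<exists>a'. \<psi> (h', a') = (f h, b) \<and> QR (f h) b = Q h' a'" for b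
      using assms(10) by (simp add: representative_values_def Q_def)
    have "\<bar>(\<Sum>b\<in>UNIV. q (f h) b * pmf (\<pi>R (f h)) b) - (\<Sum>a\<in>UNIV. Q h a * pmf (Pol h) a)\<bar>
      \<le> \<gamma> * D + 1 / (1 - \<gamma>) * (\<Sum>b\<in>UNIV. \<bar>pmf (\<pi>R (f h)) b - abs_policy \<psi> f Pol h b\<bar>)
          + eps_Q R \<psi> Q QR (f h)"
    proof (rule policy_value_diff)
      show "fst (\<psi> (h, a)) = f h" for a
        by (rule state[OF h])
      show "\<bar>q (f h) b - QR (f h) b\<bar> \<le> \<gamma> * D" for b
        using QR[of b] q_le[OF D] by force
      show "\<bar>QR (f h) b\<bar> \<le> 1 / (1 - \<gamma>)" for b
        using QR[of b] Qbd by force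
      show "\<bar>QR (f h) (snd (\<psi> (h, a))) - Q h a\<bar> \<le> eps_Q R \<psi> Q QR (f h)" for a
        by (rule eps_Q_upper[OF Qbd h]) (use state[OF h] in \<open>auto simp: prod_eq_iff\<close>)
    qed
    moreover have "v (f h) = (\<Sum>b\<in>UNIV. q (f h) b * pmf (\<pi>R (f h)) b)"
      using qv unfolding is_mdp_value_pair_def by blast
    moreover have "V h = (\<Sum>a\<in>UNIV. Q h a * pmf (Pol h) a)"
      using QV h unfolding is_value_pair_def by blast
    moreover have "1 / (1 - \<gamma>) * (\<Sum>b\<in>UNIV. \<bar>pmf (\<pi>R (f h)) b - abs_policy \<psi> f Pol h b\<bar>)
        \<le> eps_Pi R \<psi> f Pol \<pi>R (f h) / (1 - \<gamma>)"
      using eps_Pi_upper[OF h, of \<pi>R f \<psi> Pol] g by (simp add: divide_right_mono)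
    moreover have "eps_Q R \<psi> Q QR (f h) + eps_Pi R \<psi> f Pol \<pi>R (f h) / (1 - \<gamma>) \<le> E"
      unfolding E_def eps_max_def by (rule Max_ge) auto
    ultimately show "\<bar>v (f h) - V h\<bar> \<le> E + \<gamma> * D"
      by linarith
  qed
  have "s = f h"
    using state[OF \<open>h \<in> histories R\<close>, of a] \<open>\<psi> (h, a) = (s, b)\<close> by simp
  \<comment> \<open>Taking D = E / (1 - \<gamma>) in \<open>q_le\<close> produces the extra factor
    \<gamma> in the action-value bound.\<close>
  with q_le[OF v_le \<open>h \<in> histories R\<close> \<open>\<psi> (h, a) = (s, b)\<close>] v_le[OF \<open>h \<in> histories R\<close>]
  show ?thesis
    by (simp add: E_def Q_def V_def q_def v_def)
qed

end
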